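(* Let $(X,m)$ be a $\sigma$-finite measure space, let $\gamma>0$, and let $\{T_t:t>0\}$ be a family of operators acting on functions on $X$, with maximal operator $T^*f(x)=\sup_{t>0}|T_tf(x)|$. Suppose that $T_tf(x)\to f(x)$ as $t\to0^+$ for $m$-a.e. $x\in X$. Then, for $m$-a.e. $x\in X$, $$\lim_{\lambda\to\infty}\lambda\,w_\gamma\left(\left\{t>0:\frac{|T_tf(x)|}{t^\gamma}>\lambda\right\}\right)=\frac{|f(x)|}{\gamma}$$ and $$\left\|\frac{T_tf(x)}{t^\gamma}\right\|_{L_t^{1,\infty}(w_\gamma)}\le\frac1\gamma T^*f(x).$$ Consequently, $$\left\|\left\|\frac{T_tf(x)}{t^\gamma}\right\|_{L_t^{1,\infty}(w_\gamma)}\right\|_{L_x^{1,\infty}(X,m)}\le\frac1\gamma\|T^*f\|_{L^{1,\infty}(X,m)}.$$ In particular, if $T^*:L^1(X,m)\to L^{1,\infty}(X,m)$ has norm at most $C$, then the right-hand side is bounded by $C\|f\|_{L^1(X,m)}/\gamma$.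
   Context: For $\gamma\ne0$ and measurable $E\subset(0,\infty)$, $w_\gamma(E):=\int_Et^{\gamma-1}\,dt$. For a measure space $(Y,\mu)$, the weak quasi-norm is $\|g\|_{L^{1,\infty}(Y,\mu)}:=\sup_{\lambda>0}\lambda\,\mu(\{y\in Y:|g(y)|>\lambda\})$; the subscripts $t$ and $x$ indicate the variable with respect to which it is taken, and $L_t^{1,\infty}(w_\gamma)$ is over $(0,\infty)$ with measure $w_\gamma$.
   Formalization: The limit formula is stated for almost every x with T*f(x) < ∞, since it can fail where T*f(x) = ∞; T_t f(x) is assumed measurable in t for a.e. x, and T*f measurable in the mixed weak-norm bound. *)

theory Defs
  imports "HOL-Analysis.Analysis"
begin

text \<open>The measure with density \<open>t\<^sup>\<gamma>\<^sup>-\<^sup>1\<close> on the Lebesgue measurable subsets of the half-line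
  \<open>(0,\<infinity>)\<close>.\<close>

definition weight_measure :: "real \<Rightarrow> real measure"
  where "weight_measure \<gamma> = density (lebesgue_on {0<..}) (\<lambda>t. ennreal (t powr (\<gamma> - 1)))"

text \<open>The argument \<open>g\<close> stands for the absolute value of the function whose quasi-norm is taken. It is
  extended-real valued because the quasi-norm is also applied to functions that may be
  infinite (maximal functions, and quasi-norms in another variable). The superlevel sets are
  meant to be measurable; \<^const>\<open>emeasure\<close> is 0 on sets that are not.\<close>

definition weak_L1_norm :: "'y measure \<Rightarrow> ('y \<Rightarrow> ennreal) \<Rightarrow> ennreal"
  where "weak_L1_norm M g = (SUP l\<in>{0::real<..}. ennreal l * emeasure M {y \<in> space M. ennreal l < g y})"

definition maximal_op ::
  "(real \<Rightarrow> ('a \<Rightarrow> 'b::real_normed_vector) \<Rightarrow> 'a \<Rightarrow> 'b) \<Rightarrow> ('a \<Rightarrow> 'b) \<Rightarrow> 'a \<Rightarrow> ennreal"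
  where "maximal_op T f x = (SUP t\<in>{0::real<..}. ennreal (norm (T t f x)))"

text \<open>\<open>S\<close> maps \<open>L\<^sup>1\<close> to weak \<open>L\<^sup>1\<close> with norm at most \<open>C\<close>. Measurability of \<open>S g\<close> is part of membership in
  weak \<open>L\<^sup>1\<close>. As \<open>S\<close> need not be linear, its norm is the least admissible constant in the
  inequality.\<close>

definition weak_type_11_le ::
  "'a measure \<Rightarrow> (('a \<Rightarrow> 'b::{banach, second_countable_topology}) \<Rightarrow> 'a \<Rightarrow> ennreal) \<Rightarrow> real \<Rightarrow> bool"
  where "weak_type_11_le M S C \<longleftrightarrow> 0 \<le> C \<and>
    (\<forall>g. integrable M g \<longrightarrow>
      S g \<in> borel_measurable M \<and> weak_L1_norm M (S g) \<le> ennreal (C * (\<integral>x. norm (g x) \<partial>M)))"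

end

theory Submission
  imports Defs
begin

text \<open>Since \<open>(0, a)\<close> has weighted measure \<open>a\<^sup>\<gamma> / \<gamma>\<close>, the set \<open>{t > 0. c / t\<^sup>\<gamma> > l} = (0, (c / l)\<^sup>1\<^sup>/\<^sup>\<gamma>)\<close> has
  measure exactly \<open>c / (\<gamma> l)\<close>. Bounding \<open>|T\<^sub>t f(x)|\<close> by \<open>c = T\<^sup>* f(x)\<close> gives the weak-type bound. This
  bound also confines the superlevel sets to small \<open>t\<close> once \<open>l\<close> is large, and there \<open>|T\<^sub>t f(x)|\<close> lies
  between \<open>|f(x)| - \<epsilon>\<close> and \<open>|f(x)| + \<epsilon>\<close>, which gives the limit.\<close>

section \<open>Weighted measure of intervals at the origin\<close>

lemma sets_weight_measure [simp, measurable_cong]: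
  "sets (weight_measure \<gamma>) = sets (lebesgue_on {0<..})"
  and space_weight_measure [simp]: "space (weight_measure \<gamma>) = {0<..}"
  by (simp_all add: weight_measure_def)

lemma emeasure_weight_measure_interval:
  assumes "\<gamma> > 0" "a \<ge> 0"
  shows "emeasure (weight_measure \<gamma>) {0<..<a} = ennreal (a powr \<gamma> / \<gamma>)"
proof -
  \<comment> \<open>The exponent exceeds -1 because \<open>\<gamma> > 0\<close>, so the density is
    integrable at 0; passing from the closed to the open interval leaves the integral
    unchanged.\<close>
  have I: "((\<lambda>t. t powr (\<gamma> - 1)) has_integral (a powr \<gamma> / \<gamma>)) {0<..<a}"
    using has_integral_powr_from_0[of "\<gamma> - 1" a] assms has_integral_Icc_iff_Ioo by auto
  have S: "{0<..<a} \<in> sets (lebesgue_on {0<..})"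
    by (auto simp: sets_restrict_space_iff)
  have "emeasure (weight_measure \<gamma>) {0<..<a}
      = (\<integral>\<^sup>+t. ennreal (t powr (\<gamma> - 1)) * indicator {0<..<a} t \<partial>lebesgue_on {0<..})"
    unfolding weight_measure_def
    by (rule emeasure_density[OF _ S]) (intro measurable_restrict_space1 measurable_completion, measurable)
  also have "\<dots> = (\<integral>\<^sup>+t. ennreal (t powr (\<gamma> - 1)) * indicator {0<..<a} t * indicator {0<..} t \<partial>lebesgue)"
    by (subst nn_integral_restrict_space) auto
  also have "\<dots> = (\<integral>\<^sup>+t. ennreal (indicator {0<..<a} t * t powr (\<gamma> - 1)) \<partial>lebesgue)"
    by (intro nn_integral_cong) (auto simp: indicator_def)
  also have "\<dots> = ennreal (a powr \<gamma> / \<gamma>)"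
    by (subst nn_integral_completion, rule nn_integral_has_integral_lebesgue[OF _ I]) auto
  finally show ?thesis .
qed

text \<open>The power \<open>\<gamma>\<close> in the measure of the interval cancels the root,
  leaving \<open>c / l\<close>, and the factor \<open>l\<close> removes the level. This independence
  of \<open>l\<close> gives both the supremum bound and the limit.\<close>

lemma weight_measure_scaled_interval:
  assumes "\<gamma> > 0" "l > 0" "c \<ge> 0"
  shows "ennreal l * emeasure (weight_measure \<gamma>) {0<..<(c / l) powr (1 / \<gamma>)} = ennreal (c / \<gamma>)"
  using assms
  by (simp add: emeasure_weight_measure_interval powr_powr ennreal_mult[symmetric])

lemma less_root_iff:
  fixes \<gamma> l c t :: real
  assumes "\<gamma> > 0" "l > 0" "c \<ge> 0" "t > 0"
  shows "t < (c / l) powr (1 / \<gamma>) \<longleftrightarrow> l < c / t powr \<gamma>"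
proof -
  have "t < (c / l) powr (1 / \<gamma>) \<longleftrightarrow> t powr \<gamma> < ((c / l) powr (1 / \<gamma>)) powr \<gamma>"
    using assms by (metis less_eq_real_def linorder_not_less powr_ge_zero powr_less_mono2)
  also have "\<dots> \<longleftrightarrow> t powr \<gamma> < c / l"
    using assms by (simp add: powr_powr)
  also have "\<dots> \<longleftrightarrow> l < c / t powr \<gamma>"
    using assms by (simp add: field_simps)
  finally show ?thesis .
qed

section \<open>Superlevel sets at a fixed level and at large levels\<close>

text \<open>The bound on \<open>N\<close> is asked for only on the superlevel set itself, so that
  \<open>c\<close> can be a global bound or one valid only near 0.\<close>

lemma weight_superlevel_upper:
  assumes "\<gamma> > 0" "l > 0" "c \<ge> 0" "\<And>t. t > 0 \<Longrightarrow> l < N t / t powr \<gamma> \<Longrightarrow> N t \<le> c"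
  shows "ennreal l * emeasure (weight_measure \<gamma>) {t. t > 0 \<and> N t / t powr \<gamma> > l} \<le> ennreal (c / \<gamma>)"
proof -
  have sub: "{t. t > 0 \<and> N t / t powr \<gamma> > l} \<subseteq> {0<..<(c / l) powr (1 / \<gamma>)}"
  proof (intro subsetI, clarsimp)
    fix t :: real assume t: "0 < t" "l < N t / t powr \<gamma>"
    then have "N t / t powr \<gamma> \<le> c / t powr \<gamma>"
      by (intro divide_right_mono assms) auto
    then show "t < (c / l) powr (1 / \<gamma>)"
      using t assms(1-3) by (subst less_root_iff) auto
  qed
  have "emeasure (weight_measure \<gamma>) {t. t > 0 \<and> N t / t powr \<gamma> > l}
      \<le> emeasure (weight_measure \<gamma>) {0<..<(c / l) powr (1 / \<gamma>)}"
    by (rule emeasure_mono[OF sub]) (auto simp: sets_restrict_space_iff)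
  then have "ennreal l * emeasure (weight_measure \<gamma>) {t. t > 0 \<and> N t / t powr \<gamma> > l}
      \<le> ennreal l * emeasure (weight_measure \<gamma>) {0<..<(c / l) powr (1 / \<gamma>)}"
    by (rule mult_left_mono) simp
  then show ?thesis
    unfolding weight_measure_scaled_interval[OF assms(1-3)] .
qed

text \<open>On the interval \<open>N\<close> dominates \<open>c\<close>, so the interval lies in the
  superlevel set. The latter is now the larger set, and monotonicity needs it measurable.\<close>

lemma weight_superlevel_lower:
  assumes "\<gamma> > 0" "l > 0" "N \<in> borel_measurable (lebesgue_on {0<..})"
    and "\<And>t. 0 < t \<Longrightarrow> t < (c / l) powr (1 / \<gamma>) \<Longrightarrow> c \<le> N t"
  shows "ennreal (c / \<gamma>) \<le> ennreal l * emeasure (weight_measure \<gamma>) {t. t > 0 \<and> N t / t powr \<gamma> > l}"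
proof (cases "c \<ge> 0")
  case True
  have sub: "{0<..<(c / l) powr (1 / \<gamma>)} \<subseteq> {t. t > 0 \<and> N t / t powr \<gamma> > l}"
  proof (intro subsetI, clarsimp)
    fix t :: real assume t: "0 < t" "t < (c / l) powr (1 / \<gamma>)"
    then have "c / t powr \<gamma> \<le> N t / t powr \<gamma>"
      by (intro divide_right_mono assms) auto
    then show "l < N t / t powr \<gamma>"
      using t assms(1,2) True less_root_iff by fastforce
  qed
  have p: "(\<lambda>t. t powr \<gamma>) \<in> borel_measurable (lebesgue_on {0<..})"
    by (intro measurable_restrict_space1 measurable_completion) measurable
  have "{t \<in> space (lebesgue_on {0<..}). N t / t powr \<gamma> > l} \<in> sets (lebesgue_on {0<..})"
    using assms(3) p by measurable
  then have "{t. t > 0 \<and> N t / t powr \<gamma> > l} \<in> sets (weight_measure \<gamma>)"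
    by simp
  then have "ennreal l * emeasure (weight_measure \<gamma>) {0<..<(c / l) powr (1 / \<gamma>)}
      \<le> ennreal l * emeasure (weight_measure \<gamma>) {t. t > 0 \<and> N t / t powr \<gamma> > l}"
    by (intro mult_left_mono emeasure_mono[OF sub]) auto
  then show ?thesis
    unfolding weight_measure_scaled_interval[OF assms(1,2) True] .
next
  \<comment> \<open>For negative \<open>c\<close> the left side is truncated to 0 by
    \<open>ennreal\<close>. This occurs for \<open>c = L - e\<close> with
    \<open>e > L\<close>.\<close>
  case False
  then show ?thesis
    using assms(1) by (simp add: ennreal_neg divide_nonpos_pos)
qed

text \<open>For each \<open>e > 0\<close> the expression is eventually squeezed between the values
  belonging to the constants \<open>L - e\<close> and \<open>L + e\<close>; then \<open>e\<close>
  tends to 0.\<close>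

lemma weight_superlevel_limit:
  assumes "\<gamma> > 0" "N \<in> borel_measurable (lebesgue_on {0<..})"
    and lim: "(N \<longlongrightarrow> L) (at_right 0)" and "L \<ge> 0" and bd: "\<And>t. t > 0 \<Longrightarrow> N t \<le> S"
  shows "((\<lambda>l. ennreal l * emeasure (weight_measure \<gamma>) {t. t > 0 \<and> N t / t powr \<gamma> > l})
    \<longlongrightarrow> ennreal (L / \<gamma>)) at_top" (is "(?h \<longlongrightarrow> _) _")
proof -
  have root: "\<forall>\<^sub>F l in at_top. (c / l) powr (1 / \<gamma>) < d" if "d > 0" for c d :: real
  proof -
    have "((\<lambda>l. c / l) \<longlongrightarrow> 0) at_top"
      by (rule tendsto_divide_0[OF tendsto_const]) (simp add: filterlim_at_top_imp_at_infinity filterlim_ident)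
    then have "\<forall>\<^sub>F l in at_top. \<bar>c / l\<bar> < d powr \<gamma>"
      using that by (auto dest!: tendstoD[where e = "d powr \<gamma>"] simp: dist_real_def)
    then show ?thesis
    proof eventually_elim
      case (elim l)
      \<comment> \<open>The real logarithm is even, so \<open>powr\<close> ignores the sign of its
        base. Negative \<open>c\<close> must be covered because \<open>root\<close> is applied to
        \<open>L - e\<close>.\<close>
      have "(c / l) powr (1 / \<gamma>) = \<bar>c / l\<bar> powr (1 / \<gamma>)"
        by (cases "c / l \<ge> 0") (simp_all add: powr_def abs_if ln_minus del: abs_divide)
      also have "\<dots> < (d powr \<gamma>) powr (1 / \<gamma>)"
        using elim assms(1) by (intro powr_less_mono2) auto
      finally show ?case
        using that assms(1) by (simp add: powr_powr)
    qed
  qed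
  have bounds: "\<forall>\<^sub>F l in at_top. ennreal ((L - e) / \<gamma>) \<le> ?h l \<and> ?h l \<le> ennreal ((L + e) / \<gamma>)"
    if e: "e > 0" for e
  proof -
    have "\<forall>\<^sub>F t in at_right 0. dist (N t) L < e"
      using lim e by (rule tendstoD)
    then obtain d where d: "d > 0" "\<And>t. 0 < t \<Longrightarrow> t < d \<Longrightarrow> \<bar>N t - L\<bar> < e"
      by (auto simp: eventually_at_right_field dist_real_def)
    show ?thesis
      \<comment> \<open>The first event confines the superlevel set to \<open>t < d\<close>;
        \<open>max S 0\<close> is the nonnegative constant that \<open>less_root_iff\<close> asks
        for. The second puts the interval of the lower bound below \<open>d\<close>.\<close>
      using root[OF d(1), of "max S 0"] root[OF d(1), of "L - e"] eventually_gt_at_top[of 0]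
    proof eventually_elim
      case (elim l)
      have "N t \<le> L + e" if "t > 0" "l < N t / t powr \<gamma>" for t
      proof -
        have "N t / t powr \<gamma> \<le> max S 0 / t powr \<gamma>"
          using bd[OF that(1)] by (intro divide_right_mono) auto
        then have "l < max S 0 / t powr \<gamma>"
          using that by linarith
        then have "t < (max S 0 / l) powr (1 / \<gamma>)"
          using that elim assms(1) by (subst less_root_iff) auto
        then have "t < d"
          using elim by linarith
        then show ?thesis
          using d(2)[of t] that by linarith
      qed
      moreover have "L - e \<le> N t" if "0 < t" "t < ((L - e) / l) powr (1 / \<gamma>)" for t
        using d(2)[of t] that elim by linarith
      ultimately show ?case
        using weight_superlevel_upper[of \<gamma> l "L + e" N] weight_superlevel_lower[of \<gamma> l N "L - e"]
          assms e elim by auto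
    qed
  qed
  \<comment> \<open>A condition that holds eventually along everything converging to the limit
    already holds at some shifted value; the sign \<open>s\<close> selects the lower or the upper
    bound.\<close>
  have ev: "\<exists>e>0. P (ennreal ((L + s * e) / \<gamma>))"
    if "\<And>F X. (X \<longlongrightarrow> ennreal (L / \<gamma>)) F \<Longrightarrow> eventually (\<lambda>e. P (X e)) (F :: real filter)" for P s
  proof -
    have "((\<lambda>e. ennreal ((L + s * e) / \<gamma>)) \<longlongrightarrow> ennreal ((L + s * 0) / \<gamma>)) (at_right 0)"
      using assms(1) by (intro tendsto_ennrealI tendsto_intros) auto
    then have "\<forall>\<^sub>F e in at_right 0. P (ennreal ((L + s * e) / \<gamma>))"
      by (intro that) simp
    then obtain d where "d > 0" "\<And>e. 0 < e \<Longrightarrow> e < d \<Longrightarrow> P (ennreal ((L + s * e) / \<gamma>))"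
      by (auto simp: eventually_at_right_field)
    then show ?thesis
      by (meson field_lbound_gt_zero)
  qed
  show ?thesis
  proof (rule order_tendstoI)
    fix a assume "a < ennreal (L / \<gamma>)"
    then obtain e where "e > 0" "a < ennreal ((L + (-1) * e) / \<gamma>)"
      using ev[of "\<lambda>y. a < y" "-1"] order_tendstoD(1) by blast
    then show "\<forall>\<^sub>F l in at_top. a < ?h l"
      using bounds[of e] by (auto elim!: eventually_mono)
  next
    fix a assume "ennreal (L / \<gamma>) < a"
    then obtain e where "e > 0" "ennreal ((L + 1 * e) / \<gamma>) < a"
      using ev[of "\<lambda>y. y < a" 1] order_tendstoD(2) by blast
    then show "\<forall>\<^sub>F l in at_top. ?h l < a"
      using bounds[of e] by (auto elim!: eventually_mono)
  qed
qed

section \<open>Comparison of weak quasi-norms\<close>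

lemma weight_weak_L1_norm_le:
  assumes "\<gamma> > 0" and bd: "\<And>t. t > 0 \<Longrightarrow> ennreal (N t) \<le> S"
  shows "weak_L1_norm (weight_measure \<gamma>) (\<lambda>t. ennreal (N t / t powr \<gamma>)) \<le> ennreal (1 / \<gamma>) * S"
proof (cases S)
  case (real s)
  have le: "N t \<le> s" if "t > 0" for t
    using bd[OF that] real by simp
  show ?thesis
    unfolding weak_L1_norm_def
  proof (intro SUP_least)
    fix l :: real assume "l \<in> {0<..}"
    then have "{t \<in> space (weight_measure \<gamma>). ennreal l < ennreal (N t / t powr \<gamma>)}
        = {t. t > 0 \<and> N t / t powr \<gamma> > l}"
      by (auto simp: ennreal_less_iff)
    then show "ennreal l * emeasure (weight_measure \<gamma>)
        {t \<in> space (weight_measure \<gamma>). ennreal l < ennreal (N t / t powr \<gamma>)} \<le> ennreal (1 / \<gamma>) * S"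
      using weight_superlevel_upper[of \<gamma> l s N] \<open>l \<in> {0<..}\<close> le assms(1) real
      by (simp add: ennreal_mult[symmetric])
  qed
next
  \<comment> \<open>The right side is infinite, since \<open>1 / \<gamma>\<close> is
    positive.\<close>
  case top
  then show ?thesis
    using assms(1) by (simp add: ennreal_mult_top)
qed

text \<open>Level \<open>l\<close> for \<open>g\<close> is compared with level \<open>l / c\<close>
  for \<open>h\<close>; writing \<open>l = c * (l / c)\<close> brings the constant out of the
  supremum.\<close>

lemma weak_L1_norm_mono_AE_cmult:
  assumes "c > 0" and [measurable]: "h \<in> borel_measurable M"
    and le: "AE x in M. g x \<le> ennreal c * h x"
  shows "weak_L1_norm M g \<le> ennreal c * weak_L1_norm M h"
  unfolding weak_L1_norm_def[of M g]
proof (intro SUP_least)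
  fix l :: real assume l: "l \<in> {0<..}"
  have *: "ennreal (l / c) < h x" if "ennreal l < ennreal c * h x" for x
  proof (rule ccontr)
    assume "\<not> ennreal (l / c) < h x"
    then have "ennreal c * h x \<le> ennreal c * ennreal (l / c)"
      by (intro mult_left_mono) auto
    also have "\<dots> = ennreal l"
      using l assms(1) by (simp add: ennreal_mult[symmetric])
    finally show False
      using that by simp
  qed
  have "emeasure M {x \<in> space M. ennreal l < g x} \<le> emeasure M {x \<in> space M. ennreal (l / c) < h x}"
  proof (rule emeasure_mono_AE)
    show "AE x in M. x \<in> {x \<in> space M. ennreal l < g x} \<longrightarrow> x \<in> {x \<in> space M. ennreal (l / c) < h x}"
      using le by eventually_elim (auto intro: * less_le_trans)
  qed measurable
  then have "ennreal l * emeasure M {x \<in> space M. ennreal l < g x}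
      \<le> (ennreal c * ennreal (l / c)) * emeasure M {x \<in> space M. ennreal (l / c) < h x}"
    using l assms(1) by (simp add: ennreal_mult[symmetric] mult_left_mono)
  also have "\<dots> \<le> ennreal c * weak_L1_norm M h"
    unfolding weak_L1_norm_def mult.assoc
    using l assms(1) by (intro mult_left_mono SUP_upper) auto
  finally show "ennreal l * emeasure M {x \<in> space M. ennreal l < g x} \<le> ennreal c * weak_L1_norm M h" .
qed

theorem theorem1p9:
  fixes M :: "'a measure"
    and \<gamma> C :: real
    and T :: "real \<Rightarrow> ('a \<Rightarrow> 'b::{real_normed_field, banach, second_countable_topology}) \<Rightarrow> 'a \<Rightarrow> 'b"
    and f :: "'a \<Rightarrow> 'b"
  assumes "sigma_finite_measure M"
    and "\<gamma> > 0"
    and "AE x in M. (\<lambda>t. T t f x) \<in> borel_measurable (lebesgue_on {0<..})"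
    and "AE x in M. ((\<lambda>t. T t f x) \<longlongrightarrow> f x) (at_right 0)"
  shows "(AE x in M. maximal_op T f x < \<infinity> \<longrightarrow>
      ((\<lambda>l. ennreal l * emeasure (weight_measure \<gamma>) {t. t > 0 \<and> norm (T t f x) / t powr \<gamma> > l})
        \<longlongrightarrow> ennreal (norm (f x) / \<gamma>)) at_top)
    \<and> (AE x in M.
      weak_L1_norm (weight_measure \<gamma>) (\<lambda>t. ennreal (norm (T t f x) / t powr \<gamma>))
        \<le> ennreal (1 / \<gamma>) * maximal_op T f x)
    \<and> (maximal_op T f \<in> borel_measurable M \<longrightarrow>
      weak_L1_norm M (\<lambda>x. weak_L1_norm (weight_measure \<gamma>) (\<lambda>t. ennreal (norm (T t f x) / t powr \<gamma>)))
        \<le> ennreal (1 / \<gamma>) * weak_L1_norm M (maximal_op T f))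
    \<and> (weak_type_11_le M (maximal_op T) C \<longrightarrow> integrable M f \<longrightarrow>
      ennreal (1 / \<gamma>) * weak_L1_norm M (maximal_op T f)
        \<le> ennreal (C * (\<integral>x. norm (f x) \<partial>M) / \<gamma>))"
proof (intro conjI impI)
  have upper: "ennreal (norm (T t f x)) \<le> maximal_op T f x" if "t > 0" for t x
    unfolding maximal_op_def using that by (intro SUP_upper) auto
  have weak: "weak_L1_norm (weight_measure \<gamma>) (\<lambda>t. ennreal (norm (T t f x) / t powr \<gamma>))
      \<le> ennreal (1 / \<gamma>) * maximal_op T f x" for x
    by (rule weight_weak_L1_norm_le[OF assms(2) upper])
  show "AE x in M. maximal_op T f x < \<infinity> \<longrightarrow>
      ((\<lambda>l. ennreal l * emeasure (weight_measure \<gamma>) {t. t > 0 \<and> norm (T t f x) / t powr \<gamma> > l})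
        \<longlongrightarrow> ennreal (norm (f x) / \<gamma>)) at_top"
    using assms(3,4)
  proof eventually_elim
    case (elim x)
    show ?case
    proof
      assume fin: "maximal_op T f x < \<infinity>"
      \<comment> \<open>Finiteness matters here: \<open>enn2real\<close> sends infinity to 0, so
        only a finite maximal function yields a real bound.\<close>
      have bd: "norm (T t f x) \<le> enn2real (maximal_op T f x)" if "t > 0" for t
        using enn2real_mono[OF upper[OF that]] fin by simp
      show "((\<lambda>l. ennreal l * emeasure (weight_measure \<gamma>) {t. t > 0 \<and> norm (T t f x) / t powr \<gamma> > l})
        \<longlongrightarrow> ennreal (norm (f x) / \<gamma>)) at_top"
        using elim assms(2) bd
        by (intro weight_superlevel_limit[where S = "enn2real (maximal_op T f x)"] tendsto_norm) auto
    qed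
  qed
  show "AE x in M. weak_L1_norm (weight_measure \<gamma>) (\<lambda>t. ennreal (norm (T t f x) / t powr \<gamma>))
      \<le> ennreal (1 / \<gamma>) * maximal_op T f x"
    using weak by simp
  show "weak_L1_norm M (\<lambda>x. weak_L1_norm (weight_measure \<gamma>) (\<lambda>t. ennreal (norm (T t f x) / t powr \<gamma>)))
      \<le> ennreal (1 / \<gamma>) * weak_L1_norm M (maximal_op T f)"
    if "maximal_op T f \<in> borel_measurable M"
    using that weak assms(2) by (intro weak_L1_norm_mono_AE_cmult) auto
  show "ennreal (1 / \<gamma>) * weak_L1_norm M (maximal_op T f) \<le> ennreal (C * (\<integral>x. norm (f x) \<partial>M) / \<gamma>)"
    if "weak_type_11_le M (maximal_op T) C" "integrable M f"
  proof -
    \<comment> \<open>The weak-type inequality is taken at \<open>g = f\<close>; the sign of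
      \<open>C\<close> later allows the two \<open>ennreal\<close> factors to be merged.\<close>
    have "0 \<le> C" and le: "weak_L1_norm M (maximal_op T f) \<le> ennreal (C * (\<integral>x. norm (f x) \<partial>M))"
      using that by (auto simp: weak_type_11_le_def)
    then have "ennreal (1 / \<gamma>) * weak_L1_norm M (maximal_op T f)
        \<le> ennreal (1 / \<gamma>) * ennreal (C * (\<integral>x. norm (f x) \<partial>M))"
      by (intro mult_left_mono) auto
    also have "\<dots> = ennreal (C * (\<integral>x. norm (f x) \<partial>M) / \<gamma>)"
      using \<open>0 \<le> C\<close> assms(2) by (simp add: ennreal_mult[symmetric])
    finally show ?thesis .
  qed
qed

end
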